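(* Let $Z$ be a generic congruence of lines in $\mathbb R^3$, let $z\in Z$, and let $L\subset\mathbb R^3$ be the line associated to $z$. There are $2$, $1$ or $0$ characteristic points on $L$. When there are two of them, there are no focal points on $L$, and vice versa. The midpoint of the characteristic points is the midpoint of the boundary points. The characteristic points lie between the boundary points.
   Context: A congruence $Z$ is a smooth regular surface in the space of oriented lines of $\mathbb R^3$, given locally by a smooth immersion $(n,x):U\to\mathbb S^2\times\mathbb R^3$, $U\subset\mathbb R^2$ open, with $(n(u,v),x(u,v))$ determining the line $x(u,v)+t\,n(u,v)$. Identifying germs of congruences with maps in $C^\infty(U,\mathbb R^5)$ (Whitney $C^\infty$-topology), a property is generic if it holds on an open dense subset. For a direction $(du,dv)\in T_zZ$ put $x'=x_udu+x_vdv$, $n'=n_udu+n_vdv$. A curve in $Z$ through $z$ with this tangent direction gives a ruled surface containing $L$; its central point on $L$ is $x+rn$ with $r=-\dfrac{x'\cdot n'}{n'\cdot n'}$, which depends only on the direction. Forms. $A=n_u\cdot n_u$, $B=n_u\cdot n_v$, $C=n_v\cdot n_v$, $a=-n_u\cdot x_u$, $b_1=-n_u\cdot x_v$, $b_2=-n_v\cdot x_u$, $c=-n_v\cdot x_v$, $b=\frac12(b_1+b_2)$, $\bar b=\frac12(b_1-b_2)$; $Q_1=C\,dv^2+2B\,du\,dv+A\,du^2$; $Q_2=(Bc-Cb)dv^2+(Ac-Ca)du\,dv+(Ab-Ba)du^2$; $Q_3=Q_2-\bar bQ_1$. For $q_i=a_idu^2+2b_idu\,dv+c_idv^2$, $\mathrm{Jac}(q_1,q_2)$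 is the determinant with rows $(dv^2,-du\,dv,du^2)$, $(a_1,b_1,c_1)$, $(a_2,b_2,c_2)$. $Q_4=\mathrm{Jac}(Q_1,Q_2)$ and $Q_5=\mathrm{Jac}(Q_3,Q_4)$. The principal directions (in which $r$ is extremal) are the solutions of $Q_2=0$; their central points on $L$ are the boundary points. The torsal directions are the solutions of $Q_3=0$; their central points are the focal points (foci). The characteristic directions are the real solutions of $Q_5=0$; their central points on $L$ are the characteristic points.
   Formalization: The claim is stated only at points z where n_u and n_v are independent, so that r is defined for every direction; at fold points of n, which occur stably, Q_5 vanishes identically, a boundary point is undefined, and every point of L can be characteristic. *)

theory Defs
  imports "HOL-Analysis.Analysis"
begin

section \<open>Smooth maps on a plane domain and the Whitney topology\<close>

fun higher_differentiable_on ::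
  "'a::real_normed_vector set \<Rightarrow> ('a \<Rightarrow> 'b::real_normed_vector) \<Rightarrow> nat \<Rightarrow> bool" where
  "higher_differentiable_on S f 0 \<longleftrightarrow> continuous_on S f"
| "higher_differentiable_on S f (Suc k) \<longleftrightarrow>
     (\<forall>z\<in>S. f differentiable (at z)) \<and>
     (\<forall>w. higher_differentiable_on S (\<lambda>z. frechet_derivative f (at z) w) k)"

definition smooth_on ::
  "'a::real_normed_vector set \<Rightarrow> ('a \<Rightarrow> 'b::real_normed_vector) \<Rightarrow> bool" where
  "smooth_on S f \<longleftrightarrow> (\<forall>k. higher_differentiable_on S f k)"

definition pd_u :: "(real \<times> real \<Rightarrow> 'b::real_normed_vector) \<Rightarrow> real \<times> real \<Rightarrow> 'b" where
  "pd_u g z = frechet_derivative g (at z) (1, 0)"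

definition pd_v :: "(real \<times> real \<Rightarrow> 'b::real_normed_vector) \<Rightarrow> real \<times> real \<Rightarrow> 'b" where
  "pd_v g z = frechet_derivative g (at z) (0, 1)"

definition whitney_nbhd ::
  "(real \<times> real) set \<Rightarrow> nat \<Rightarrow> (real \<times> real \<Rightarrow> real) \<Rightarrow>
   (real \<times> real \<Rightarrow> 'b::real_normed_vector) \<Rightarrow> (real \<times> real \<Rightarrow> 'b) set" where
  "whitney_nbhd U k \<epsilon> f =
     {g. smooth_on U g \<and>
         (\<forall>z\<in>U. \<forall>i j. i + j \<le> k \<longrightarrow>
            norm ((pd_u ^^ i) ((pd_v ^^ j) g) z - (pd_u ^^ i) ((pd_v ^^ j) f) z) < \<epsilon> z)}"

text \<open>The order \<open>k\<close> is arbitrary but finite in each basic set, and the bound \<open>\<epsilon>\<close> is a positive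
  continuous function on \<open>U\<close>, not a constant: this is the Whitney (strong) topology.
  Maps are total functions; their values off \<open>U\<close> play no role.\<close>

definition whitney_topology ::
  "(real \<times> real) set \<Rightarrow> (real \<times> real \<Rightarrow> 'b::real_normed_vector) topology" where
  "whitney_topology U =
     topology_generated_by
       {whitney_nbhd U k \<epsilon> f | k \<epsilon> f.
          smooth_on U f \<and> continuous_on U \<epsilon> \<and> (\<forall>z\<in>U. 0 < \<epsilon> z)}"

section \<open>Congruences of lines\<close>

text \<open>A map \<open>f = (n, x)\<close> assigns to \<open>z\<close> the oriented line \<open>{x z + t n z}\<close>.\<close>

type_synonym line_map = "real \<times> real \<Rightarrow> (real^3) \<times> (real^3)"

definition n_of :: "line_map \<Rightarrow> real \<times> real \<Rightarrow> real^3" where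
  "n_of f z = fst (f z)"

definition x_of :: "line_map \<Rightarrow> real \<times> real \<Rightarrow> real^3" where
  "x_of f z = snd (f z)"

definition sphere_valued :: "(real \<times> real) set \<Rightarrow> line_map \<Rightarrow> bool" where
  "sphere_valued U f \<longleftrightarrow> (\<forall>z\<in>U. n_of f z \<in> sphere 0 1)"

definition congruence :: "(real \<times> real) set \<Rightarrow> line_map \<Rightarrow> bool" where
  "congruence U f \<longleftrightarrow>
     smooth_on U f \<and> sphere_valued U f \<and> (\<forall>z\<in>U. inj (frechet_derivative f (at z)))"

text \<open>The smooth maps from \<open>U\<close> to the 5-manifold \<open>S\<^sup>2 \<times> \<real>\<^sup>3\<close> carry the subspace topology from the
  smooth maps to \<open>\<real>\<^sup>3 \<times> \<real>\<^sup>3\<close>; a chart of the sphere turns them locally into maps to \<open>\<real>\<^sup>5\<close>.\<close>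

definition line_map_space :: "(real \<times> real) set \<Rightarrow> line_map topology" where
  "line_map_space U = subtopology (whitney_topology U) {f. sphere_valued U f}"

definition generic_for_congruences ::
  "(real \<times> real) set \<Rightarrow> (line_map \<Rightarrow> bool) \<Rightarrow> bool" where
  "generic_for_congruences U P \<longleftrightarrow>
     (\<exists>G. openin (line_map_space U) G \<and>
          line_map_space U closure_of G = topspace (line_map_space U) \<and>
          (\<forall>f\<in>G. congruence U f \<longrightarrow> P f))"

section \<open>Central points\<close>

text \<open>A direction \<open>(du, dv)\<close> is a nonzero pair \<open>w\<close>, taken up to scaling.\<close>

definition n' :: "line_map \<Rightarrow> real \<times> real \<Rightarrow> real \<times> real \<Rightarrow> real^3" where
  "n' f z w = fst w *\<^sub>R pd_u (n_of f) z + snd w *\<^sub>R pd_v (n_of f) z"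

definition x' :: "line_map \<Rightarrow> real \<times> real \<Rightarrow> real \<times> real \<Rightarrow> real^3" where
  "x' f z w = fst w *\<^sub>R pd_u (x_of f) z + snd w *\<^sub>R pd_v (x_of f) z"

definition central_point :: "line_map \<Rightarrow> real \<times> real \<Rightarrow> real \<times> real \<Rightarrow> real^3" where
  "central_point f z w =
     x_of f z + (- (x' f z w \<bullet> n' f z w) / (n' f z w \<bullet> n' f z w)) *\<^sub>R n_of f z"

text \<open>The quotient in \<^const>\<open>central_point\<close> is meaningful for every direction exactly when \<open>n\<close> is
  immersive at \<open>z\<close>. Where \<open>n\<^sub>u\<close> and \<open>n\<^sub>v\<close> are dependent, the forms \<open>Q3\<close>, \<open>Q4\<close> and \<open>Q5\<close> below
  vanish identically.\<close>

definition central_points_defined :: "line_map \<Rightarrow> real \<times> real \<Rightarrow> bool" where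
  "central_points_defined f z \<longleftrightarrow> (\<forall>w. w \<noteq> 0 \<longrightarrow> n' f z w \<bullet> n' f z w \<noteq> 0)"

section \<open>Binary quadratic forms\<close>

text \<open>The triple \<open>(a, b, c)\<close> stands for \<open>a du\<^sup>2 + 2 b du dv + c dv\<^sup>2\<close>; note the factor 2.\<close>

type_synonym qform = "real \<times> real \<times> real"

fun qeval :: "qform \<Rightarrow> real \<times> real \<Rightarrow> real" where
  "qeval (a, b, c) (du, dv) = a * du\<^sup>2 + 2 * b * du * dv + c * dv\<^sup>2"

fun Jac :: "qform \<Rightarrow> qform \<Rightarrow> qform" where
  "Jac (a1, b1, c1) (a2, b2, c2) =
     (a1 * b2 - b1 * a2, (a1 * c2 - c1 * a2) / 2, b1 * c2 - c1 * b2)"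

lemma qeval_Jac:
  "qeval (Jac (a1, b1, c1) (a2, b2, c2)) (du, dv) =
     det (vector [vector [dv\<^sup>2, - (du * dv), du\<^sup>2],
                  vector [a1, b1, c1],
                  vector [a2, b2, c2]] :: real^3^3)"
  by (simp add: det_3 algebra_simps diff_divide_distrib)

section \<open>The forms of a congruence\<close>

definition cA :: "line_map \<Rightarrow> real \<times> real \<Rightarrow> real" where
  "cA f z = pd_u (n_of f) z \<bullet> pd_u (n_of f) z"

definition cB :: "line_map \<Rightarrow> real \<times> real \<Rightarrow> real" where
  "cB f z = pd_u (n_of f) z \<bullet> pd_v (n_of f) z"

definition cC :: "line_map \<Rightarrow> real \<times> real \<Rightarrow> real" where
  "cC f z = pd_v (n_of f) z \<bullet> pd_v (n_of f) z"

definition ca :: "line_map \<Rightarrow> real \<times> real \<Rightarrow> real" where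
  "ca f z = - (pd_u (n_of f) z \<bullet> pd_u (x_of f) z)"

definition cb1 :: "line_map \<Rightarrow> real \<times> real \<Rightarrow> real" where
  "cb1 f z = - (pd_u (n_of f) z \<bullet> pd_v (x_of f) z)"

definition cb2 :: "line_map \<Rightarrow> real \<times> real \<Rightarrow> real" where
  "cb2 f z = - (pd_v (n_of f) z \<bullet> pd_u (x_of f) z)"

definition cc :: "line_map \<Rightarrow> real \<times> real \<Rightarrow> real" where
  "cc f z = - (pd_v (n_of f) z \<bullet> pd_v (x_of f) z)"

definition cb :: "line_map \<Rightarrow> real \<times> real \<Rightarrow> real" where
  "cb f z = (cb1 f z + cb2 f z) / 2"

definition cbbar :: "line_map \<Rightarrow> real \<times> real \<Rightarrow> real" where
  "cbbar f z = (cb1 f z - cb2 f z) / 2"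

definition Q1 :: "line_map \<Rightarrow> real \<times> real \<Rightarrow> qform" where
  "Q1 f z = (cA f z, cB f z, cC f z)"

definition Q2 :: "line_map \<Rightarrow> real \<times> real \<Rightarrow> qform" where
  "Q2 f z =
     (cA f z * cb f z - cB f z * ca f z,
      (cA f z * cc f z - cC f z * ca f z) / 2,
      cB f z * cc f z - cC f z * cb f z)"

definition Q3 :: "line_map \<Rightarrow> real \<times> real \<Rightarrow> qform" where
  "Q3 f z = Q2 f z - cbbar f z *\<^sub>R Q1 f z"

definition Q4 :: "line_map \<Rightarrow> real \<times> real \<Rightarrow> qform" where
  "Q4 f z = Jac (Q1 f z) (Q2 f z)"

definition Q5 :: "line_map \<Rightarrow> real \<times> real \<Rightarrow> qform" where
  "Q5 f z = Jac (Q3 f z) (Q4 f z)"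

section \<open>Boundary, focal and characteristic points\<close>

definition principal_direction :: "line_map \<Rightarrow> real \<times> real \<Rightarrow> real \<times> real \<Rightarrow> bool" where
  "principal_direction f z w \<longleftrightarrow> w \<noteq> 0 \<and> qeval (Q2 f z) w = 0"

definition torsal_direction :: "line_map \<Rightarrow> real \<times> real \<Rightarrow> real \<times> real \<Rightarrow> bool" where
  "torsal_direction f z w \<longleftrightarrow> w \<noteq> 0 \<and> qeval (Q3 f z) w = 0"

definition characteristic_direction :: "line_map \<Rightarrow> real \<times> real \<Rightarrow> real \<times> real \<Rightarrow> bool" where
  "characteristic_direction f z w \<longleftrightarrow> w \<noteq> 0 \<and> qeval (Q5 f z) w = 0"

definition boundary_points :: "line_map \<Rightarrow> real \<times> real \<Rightarrow> (real^3) set" where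
  "boundary_points f z = {central_point f z w | w. principal_direction f z w}"

definition focal_points :: "line_map \<Rightarrow> real \<times> real \<Rightarrow> (real^3) set" where
  "focal_points f z = {central_point f z w | w. torsal_direction f z w}"

definition characteristic_points :: "line_map \<Rightarrow> real \<times> real \<Rightarrow> (real^3) set" where
  "characteristic_points f z = {central_point f z w | w. characteristic_direction f z w}"

end

theory Submission
  imports Defs
begin

text \<open>
  The result is a statement about two binary quadratic forms at a single point. Write
  \<open>R = a du\<^sup>2 + 2 b du dv + c dv\<^sup>2\<close>, so that a direction has central point \<open>x + r n\<close> with
  \<open>r = R / Q1\<close>; where all central points are defined, \<open>Q1\<close> is positive definite, and
  \<open>Q2 = Jac(Q1, R)\<close>. Put \<open>D = A C - B\<^sup>2\<close>.

  The forms \<open>Q1\<close>, \<open>R\<close> and \<open>Q2\<close> satisfy a quadratic syzygy. After division by \<open>Q1\<^sup>2\<close> it says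
  that the pair \<open>(\<rho>, \<sigma>)\<close> formed by \<open>\<rho> = r - m\<close>, with \<open>m\<close> half the trace of \<open>R\<close> relative to \<open>Q1\<close>,
  and \<open>\<sigma> = Q2 / (\<surd>D Q1)\<close> lies on the circle \<open>\<rho>\<^sup>2 + \<sigma>\<^sup>2 = \<kappa>\<^sup>2\<close> (lemma \<open>circle\<close>). A direction at
  angle \<open>\<theta>\<close> in a basis orthonormal for \<open>Q1\<close> gives the point at angle \<open>-2\<theta>\<close> from a fixed one, so
  every point of the circle is attained (lemma \<open>circle_onto\<close>).

  In these coordinates each special class of directions is a horizontal slice of the circle. Let
  \<open>\<tau>\<close> be the skew coefficient \<open>b\<close>-bar divided by \<open>\<surd>D\<close>. Principal directions are \<open>\<sigma> = 0\<close>,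
  torsal ones are \<open>\<sigma> = \<tau>\<close>, and characteristic ones are \<open>\<tau> \<sigma> = \<kappa>\<^sup>2\<close>. If \<open>\<kappa> > 0\<close>, the torsal
  slice and the characteristic slice have inverse heights with respect to the circle (the
  latter lies at infinity if \<open>\<tau> = 0\<close>): one crosses it exactly when the other misses it, and
  they coincide when they touch it. The boundary points
  are \<open>\<rho> = \<kappa>\<close> and \<open>\<rho> = -\<kappa>\<close>. A horizontal slice has \<open>\<rho>\<close>-values that are symmetric about \<open>0\<close>,
  whence the common midpoint. The characteristic slice is never the diameter \<open>\<sigma> = 0\<close>, so its
  points have \<open>\<bar>\<rho>\<bar> < \<kappa>\<close>, whence the position between the boundary points.
  If \<open>\<kappa> = 0\<close>, then \<open>r\<close> is constant and all boundary and characteristic points coincide.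

  The argument applies to each map and each point separately, so the whole space of maps
  is the required open dense set.
\<close>

section \<open>The circle of a definite form and a second form\<close>

text \<open>
  Here \<open>(A, B, C)\<close> plays the role of \<open>Q1\<close>, \<open>(a, b, c)\<close> that of \<open>- x' \<bullet> n'\<close>, and \<open>\<beta>\<close> that of
  \<open>b\<close>-bar.
\<close>

locale quadratic_pencil =
  fixes A B C a b c \<beta> :: real
  assumes A_pos: "A > 0" and det_pos: "A * C - B\<^sup>2 > 0"
begin

definition D :: real where "D = A * C - B\<^sup>2"

text \<open>If \<open>\<lambda>\<close> and \<open>\<mu>\<close> are the eigenvalues of the second form relative to the first, then \<open>mean\<close>
  is \<open>(\<lambda> + \<mu>) / 2\<close> and \<open>\<kappa>\<close> is \<open>\<bar>\<lambda> - \<mu>\<bar> / 2\<close>: the quotient \<open>(a c - b\<^sup>2) / D\<close> is \<open>\<lambda> \<mu>\<close>.\<close>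

definition mean :: real where "mean = (A * c + C * a - 2 * B * b) / (2 * D)"

definition \<kappa> :: real where "\<kappa> = sqrt (mean\<^sup>2 - (a * c - b\<^sup>2) / D)"

definition \<tau> :: real where "\<tau> = \<beta> / sqrt D"

abbreviation q :: qform where "q \<equiv> (A, B, C)"

abbreviation r :: qform where "r \<equiv> (a, b, c)"

definition \<rho> :: "real \<times> real \<Rightarrow> real" where
  "\<rho> w = qeval r w / qeval q w - mean"

definition \<sigma> :: "real \<times> real \<Rightarrow> real" where
  "\<sigma> w = qeval (Jac q r) w / (sqrt D * qeval q w)"

lemma D_pos: "D > 0"
  using det_pos by (simp add: D_def)

lemma q_pos:
  assumes "w \<noteq> 0"
  shows "qeval q w > 0"
proof -
  obtain x y where w: "w = (x, y)" by (cases w)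
  have sq: "A * qeval q w = (A * x + B * y)\<^sup>2 + D * y\<^sup>2"
    by (simp add: w D_def power2_eq_square algebra_simps)
  have "(A * x + B * y)\<^sup>2 + D * y\<^sup>2 > 0"
  proof (cases "y = 0")
    case True
    then show ?thesis using assms A_pos by (auto simp: w zero_prod_def)
  next
    case False
    then show ?thesis using D_pos by (intro add_nonneg_pos) auto
  qed
  then show ?thesis using sq A_pos by (metis zero_less_mult_pos)
qed

lemma qeval_Jac_q_r:
  "qeval (Jac q r) (x, y) = (A * b - B * a) * x\<^sup>2 + (A * c - C * a) * x * y + (B * c - C * b) * y\<^sup>2"
  by simp

text \<open>The radicand of \<open>\<kappa>\<close> is nonnegative because it is the squared distance from the centre of the
  point \<open>(\<rho>, \<sigma>)\<close> belonging to the direction \<open>(1, 0)\<close>; the two squares are those of its coordinates.\<close>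

lemma radicand_eq_sum_of_squares: 
  "mean\<^sup>2 - (a * c - b\<^sup>2) / D
    = ((a - A * mean) / A)\<^sup>2 + ((A * b - B * a) / (A * sqrt D))\<^sup>2"
proof -
  have m: "2 * D * mean = A * c + C * a - 2 * B * b"
    using D_pos by (simp add: mean_def)
  have "A\<^sup>2 * (D * mean\<^sup>2 - (a * c - b\<^sup>2)) = D * (a - A * mean)\<^sup>2 + (A * b - B * a)\<^sup>2 
       + a * A * (2 * D * mean) - a\<^sup>2 * D - A\<^sup>2 * (a * c - b\<^sup>2) - (A * b - B * a)\<^sup>2"
    by (simp add: power2_eq_square algebra_simps)
  also have "\<dots> = D * (a - A * mean)\<^sup>2 + (A * b - B * a)\<^sup>2"
    unfolding m unfolding D_def by (simp add: power2_eq_square algebra_simps)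
  finally have "A\<^sup>2 * (D * mean\<^sup>2 - (a * c - b\<^sup>2)) = D * (a - A * mean)\<^sup>2 + (A * b - B * a)\<^sup>2" .
  then show ?thesis
    using D_pos A_pos
    by (simp add: power_divide power_mult_distrib divide_simps) (simp add: algebra_simps)
qed

lemma \<kappa>_sq: "\<kappa>\<^sup>2 = mean\<^sup>2 - (a * c - b\<^sup>2) / D"
  unfolding \<kappa>_def radicand_eq_sum_of_squares by simp

lemma \<kappa>_nonneg: "\<kappa> \<ge> 0"
  unfolding \<kappa>_def radicand_eq_sum_of_squares by simp

text \<open>This is the syzygy \<open>D r\<^sup>2 - 2 D m r q + Jac(q, r)\<^sup>2 + (a c - b\<^sup>2) q\<^sup>2 = 0\<close> with the square in \<open>r\<close>
  completed.\<close>

lemma circle: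
  assumes "w \<noteq> 0"
  shows "(\<rho> w)\<^sup>2 + (\<sigma> w)\<^sup>2 = \<kappa>\<^sup>2"
proof -
  obtain x y where w: "w = (x, y)" by (cases w)
  define I R J where "I = qeval q w" and "R = qeval r w" and "J = qeval (Jac q r) w"
  have I: "I \<noteq> 0" using q_pos[OF assms] by (simp add: I_def)
  have m: "2 * D * mean = A * c + C * a - 2 * B * b"
    using D_pos by (simp add: mean_def)
  have "D * R\<^sup>2 - (A * c + C * a - 2 * B * b) * R * I + J\<^sup>2 + (a * c - b\<^sup>2) * I\<^sup>2 = 0"
    unfolding I_def R_def J_def w D_def qeval_Jac_q_r unfolding qeval.simps by algebra
  then have "D * (R - mean * I)\<^sup>2 + J\<^sup>2 = (D * mean\<^sup>2 - (a * c - b\<^sup>2)) * I\<^sup>2"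
    unfolding m[symmetric] by algebra
  then show ?thesis
    unfolding \<kappa>_sq \<rho>_def \<sigma>_def I_def[symmetric] R_def[symmetric] J_def[symmetric]
    using D_pos I
    by (simp add: power_divide power_mult_distrib divide_simps) (simp add: algebra_simps)
qed

text \<open>In a basis orthonormal for \<open>q\<close> up to scale, the direction \<open>(cos \<theta>, sin \<theta>)\<close> has
  \<open>\<rho> = p cos 2\<theta> + k sin 2\<theta>\<close> and \<open>\<sigma> = k cos 2\<theta> - p sin 2\<theta>\<close>. This rotates the point \<open>(p, k)\<close> of the
  circle through \<open>-2\<theta>\<close>, and half of any prescribed angle can be used for \<open>\<theta>\<close>.\<close>

lemma circle_onto:
  assumes "s\<^sup>2 + t\<^sup>2 = \<kappa>\<^sup>2"
  obtains w where "w \<noteq> 0" "\<rho> w = s" "\<sigma> w = t"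
proof -
  define p where "p = (a - A * mean) / A"
  define k where "k = (A * b - B * a) / (A * sqrt D)"
  have pk: "\<kappa>\<^sup>2 = p\<^sup>2 + k\<^sup>2"
    unfolding \<kappa>_sq radicand_eq_sum_of_squares p_def k_def ..
  have "\<exists>\<theta>. p * cos (2*\<theta>) + k * sin (2*\<theta>) = s \<and> k * cos (2*\<theta>) - p * sin (2*\<theta>) = t"
  proof (cases "\<kappa> = 0")
    case True
    then show ?thesis using assms pk by (simp add: sum_power2_eq_zero_iff)
  next
    case False
    \<comment> \<open>\<open>X\<close> and \<open>Y\<close> are the cosine and sine of the angle from \<open>(s, t)\<close> to \<open>(p, k)\<close>.\<close>
    define X Y where "X = (p * s + k * t) / \<kappa>\<^sup>2" and "Y = (k * s - p * t) / \<kappa>\<^sup>2"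
    have "(p * s + k * t)\<^sup>2 + (k * s - p * t)\<^sup>2 = (p\<^sup>2 + k\<^sup>2) * (s\<^sup>2 + t\<^sup>2)" by algebra
    also have "\<dots> = (\<kappa>\<^sup>2)\<^sup>2" using assms pk by (simp add: power2_eq_square)
    finally have "X\<^sup>2 + Y\<^sup>2 = 1"
      using False by (simp add: X_def Y_def power_divide add_divide_distrib[symmetric])
    then obtain \<phi> where \<phi>: "X = cos \<phi>" "Y = sin \<phi>" by (metis sincos_total_2pi)
    have "p * X + k * Y = (p\<^sup>2 + k\<^sup>2) * s / \<kappa>\<^sup>2" "k * X - p * Y = (p\<^sup>2 + k\<^sup>2) * t / \<kappa>\<^sup>2"
      by (simp_all add: X_def Y_def add_divide_distrib[symmetric] diff_divide_distrib[symmetric]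
            power2_eq_square algebra_simps)
    then show ?thesis
      using False unfolding pk[symmetric] \<phi> by (intro exI[of _ "\<phi> / 2"]) simp
  qed
  then obtain \<theta> where \<theta>: "p * cos (2*\<theta>) + k * sin (2*\<theta>) = s" "k * cos (2*\<theta>) - p * sin (2*\<theta>) = t"
    by blast
  define x y e where "x = cos \<theta>" and "y = sin \<theta>" and "e = inverse (sqrt D)"
  have xy: "x\<^sup>2 + y\<^sup>2 = 1" by (simp add: x_def y_def)
  have e: "D * e\<^sup>2 = 1" using D_pos by (simp add: e_def power_inverse)
  have e0: "e \<noteq> 0" using D_pos by (simp add: e_def)
  have dbl: "cos (2*\<theta>) = x\<^sup>2 - y\<^sup>2" "sin (2*\<theta>) = 2 * x * y"
    by (simp_all add: x_def y_def cos_double sin_double)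
  \<comment> \<open>Gram-Schmidt applied to the standard basis, scaled so that the first vector is \<open>(1, 0)\<close>;
    both vectors then have \<open>q\<close>-value \<open>A\<close>.\<close>
  define w where "w = (x - B * e * y, A * e * y)"
  have w0: "w \<noteq> 0"
    using xy A_pos e0 by (auto simp: w_def zero_prod_def)
  have De: "(A * C - B\<^sup>2) * e\<^sup>2 = 1" using e by (simp add: D_def)
  have "qeval q w = A * (x\<^sup>2 + (A * C - B\<^sup>2) * e\<^sup>2 * y\<^sup>2)"
    unfolding w_def qeval.simps by algebra
  then have qw: "qeval q w = A" using De xy by simp
  have m: "A * c + C * a - 2 * B * b = 2 * D * mean"
    using D_pos by (simp add: mean_def)
  have Ap: "A * p = a - A * mean" using A_pos by (simp add: p_def)
  have Ak: "A * k = (A * b - B * a) * e"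
    using A_pos by (simp add: k_def e_def divide_simps)
  have "qeval r w = a * (x\<^sup>2 - (A * C - B\<^sup>2) * e\<^sup>2 * y\<^sup>2) + 2 * x * y * ((A * b - B * a) * e)
      + A * (A * c + C * a - 2 * B * b) * e\<^sup>2 * y\<^sup>2"
    unfolding w_def qeval.simps by algebra
  also have "\<dots> = a * (x\<^sup>2 - y\<^sup>2) + 2 * x * y * (A * k) + 2 * A * mean * (D * e\<^sup>2) * y\<^sup>2"
    unfolding De m Ak by simp
  also have "\<dots> = A * mean * (x\<^sup>2 + y\<^sup>2) + (A * p) * (x\<^sup>2 - y\<^sup>2) + 2 * x * y * (A * k)"
    unfolding Ap e by (simp add: algebra_simps)
  also have "\<dots> = A * (mean + s)"
    by (simp add: \<theta>(1)[symmetric, unfolded dbl] xy algebra_simps)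
  finally have "qeval r w = A * (mean + s)" .
  then have \<rho>: "\<rho> w = s" using qw A_pos by (simp add: \<rho>_def)
  have J: "qeval (Jac q r) w = (A * b - B * a) * (x\<^sup>2 - (A * C - B\<^sup>2) * e\<^sup>2 * y\<^sup>2)
      + x * y * e * (A * (A * c + C * a - 2 * B * b) - 2 * a * (A * C - B\<^sup>2))"
    unfolding w_def qeval_Jac_q_r by algebra
  have "e * qeval (Jac q r) w
      = (A * b - B * a) * e * (x\<^sup>2 - y\<^sup>2) - 2 * x * y * (a - A * mean) * (D * e\<^sup>2)"
    unfolding J De m unfolding D_def[symmetric] by (simp add: power2_eq_square algebra_simps)
  also have "\<dots> = A * (k * (x\<^sup>2 - y\<^sup>2) - p * (2 * x * y))"
    unfolding e Ap[symmetric] Ak[symmetric] by (simp add: algebra_simps)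
  also have "\<dots> = A * t" using \<theta>(2) by (simp add: dbl)
  finally have \<sigma>: "\<sigma> w = t"
    using qw A_pos D_pos by (simp add: \<sigma>_def e_def divide_simps mult.commute del: Jac.simps)
  show thesis using that w0 \<rho> \<sigma> by blast
qed

section \<open>Special directions as horizontal slices\<close>

lemma principal_iff:
  assumes "w \<noteq> 0"
  shows "qeval (Jac q r) w = 0 \<longleftrightarrow> \<sigma> w = 0"
  using q_pos[OF assms] D_pos by (auto simp: \<sigma>_def)

lemma torsal_iff:
  assumes "w \<noteq> 0"
  shows "qeval (Jac q r - \<beta> *\<^sub>R q) w = 0 \<longleftrightarrow> \<sigma> w = \<tau>"
proof -
  have "qeval (Jac q r - \<beta> *\<^sub>R q) w = qeval (Jac q r) w - \<beta> * qeval q w"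
    by (cases w) (simp add: algebra_simps)
  also have "\<dots> = 0 \<longleftrightarrow> \<sigma> w = \<tau>"
    using q_pos[OF assms] D_pos by (auto simp: \<sigma>_def \<tau>_def divide_simps)
  finally show ?thesis .
qed

text \<open>With \<open>Q2 = Jac(q, r)\<close> and \<open>Q4 = Jac(q, Q2)\<close>, bilinearity makes the form \<open>Jac(Q2, Q4) - \<beta> Jac(q, Q4)\<close>. Iterating \<open>Jac\<close> returns to the pencil:
  \<open>Q4\<close> equals \<open>- D (r - m q)\<close>, so \<open>Jac(q, Q4) = - D Q2\<close>, and \<open>Jac(Q2, Q4) = - D\<^sup>2 \<kappa>\<^sup>2 q\<close>. Hence
  the form is \<open>\<beta> D Q2 - D\<^sup>2 \<kappa>\<^sup>2 q\<close>.\<close>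

lemma characteristic_iff:
  assumes "w \<noteq> 0"
  shows "qeval (Jac (Jac q r - \<beta> *\<^sub>R q) (Jac q (Jac q r))) w = 0 \<longleftrightarrow> \<tau> * \<sigma> w = \<kappa>\<^sup>2"
proof -
  obtain x y where w: "w = (x, y)" by (cases w)
  have "qeval (Jac (Jac q r - \<beta> *\<^sub>R q) (Jac q (Jac q r))) w =
      \<beta> * D * qeval (Jac q r) w 
      - ((A * c + C * a - 2 * B * b)\<^sup>2 / 4 - D * (a * c - b\<^sup>2)) * qeval q w"
    unfolding w D_def by (simp add: power2_eq_square field_simps)
  also have "(A * c + C * a - 2 * B * b)\<^sup>2 / 4 - D * (a * c - b\<^sup>2) = D\<^sup>2 * \<kappa>\<^sup>2"
    unfolding \<kappa>_sq mean_def using D_pos by (simp add: field_simps power2_eq_square)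
  also have "\<beta> * D * qeval (Jac q r) w = D\<^sup>2 * qeval q w * (\<tau> * \<sigma> w)"
    using q_pos[OF assms] D_pos by (simp add: \<sigma>_def \<tau>_def power2_eq_square)
  also have "D\<^sup>2 * qeval q w * (\<tau> * \<sigma> w) - D\<^sup>2 * \<kappa>\<^sup>2 * qeval q w = 0 \<longleftrightarrow> \<tau> * \<sigma> w = \<kappa>\<^sup>2"
  proof -
    have "D\<^sup>2 * qeval q w * (\<tau> * \<sigma> w) - D\<^sup>2 * \<kappa>\<^sup>2 * qeval q w 
       = D\<^sup>2 * qeval q w * (\<tau> * \<sigma> w - \<kappa>\<^sup>2)" by (simp add: algebra_simps)
    then show ?thesis using q_pos[OF assms] D_pos by simp
  qed
  finally show ?thesis .
qed

lemma values_at_height: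
  assumes "\<bar>t\<bar> \<le> \<kappa>"
  shows "{\<rho> w | w. w \<noteq> 0 \<and> \<sigma> w = t}
    = {- sqrt (\<kappa>\<^sup>2 - t\<^sup>2), sqrt (\<kappa>\<^sup>2 - t\<^sup>2)}" (is "?S = {- ?s, ?s}")
proof
  have le: "t\<^sup>2 \<le> \<kappa>\<^sup>2" using assms by (metis abs_le_square_iff abs_of_nonneg \<kappa>_nonneg)
  show "?S \<subseteq> {- ?s, ?s}"
  proof
    fix v assume "v \<in> ?S"
    then obtain w where "w \<noteq> 0" "\<sigma> w = t" "v = \<rho> w" by blast
    then have "v\<^sup>2 = ?s\<^sup>2" using circle[of w] le by simp
    then show "v \<in> {- ?s, ?s}" by (auto simp: power2_eq_iff)
  qed
  have "v \<in> ?S" if "v\<^sup>2 + t\<^sup>2 = \<kappa>\<^sup>2" for v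
    using circle_onto[OF that] by blast
  then show "{- ?s, ?s} \<subseteq> ?S" using le by auto
qed

lemma no_values_beyond:
  assumes "\<kappa> < \<bar>t\<bar>"
  shows "{\<rho> w | w. w \<noteq> 0 \<and> \<sigma> w = t} = {}"
proof -
  have "\<sigma> w \<noteq> t" if "w \<noteq> 0" for w
  proof
    assume "\<sigma> w = t"
    then have "t\<^sup>2 \<le> \<kappa>\<^sup>2"
      using circle[OF that] zero_le_power2[of "\<rho> w"] unfolding \<open>\<sigma> w = t\<close> by linarith
    then show False using assms by (metis abs_le_square_iff abs_of_nonneg \<kappa>_nonneg not_less)
  qed
  then show ?thesis by blast
qed

lemma principal_values:
  "{\<rho> w | w. w \<noteq> 0 \<and> qeval (Jac q r) w = 0} = {- \<kappa>, \<kappa>}"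
proof -
  have "{\<rho> w | w. w \<noteq> 0 \<and> qeval (Jac q r) w = 0} = {\<rho> w | w. w \<noteq> 0 \<and> \<sigma> w = 0}"
    using principal_iff by blast
  also have "\<dots> = {- \<kappa>, \<kappa>}"
    using values_at_height[of 0] \<kappa>_nonneg by simp
  finally show ?thesis .
qed

lemma torsal_values:
  "{\<rho> w | w. w \<noteq> 0 \<and> qeval (Jac q r - \<beta> *\<^sub>R q) w = 0} =
     (if \<bar>\<tau>\<bar> \<le> \<kappa> then {- sqrt (\<kappa>\<^sup>2 - \<tau>\<^sup>2), sqrt (\<kappa>\<^sup>2 - \<tau>\<^sup>2)} else {})"
proof -
  have "{\<rho> w | w. w \<noteq> 0 \<and> qeval (Jac q r - \<beta> *\<^sub>R q) w = 0} = {\<rho> w | w. w \<noteq> 0 \<and> \<sigma> w = \<tau>}"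
    using torsal_iff by blast
  then show ?thesis
    using values_at_height[of \<tau>] no_values_beyond[of \<tau>] by (simp add: not_le)
qed

text \<open>Half the length of the chord that the characteristic slice \<open>\<sigma> = \<kappa>\<^sup>2 / \<tau>\<close> cuts out. When
  \<open>\<tau> = 0\<close>, division by zero gives \<open>\<eta> = \<kappa>\<close>; the value matters only for \<open>\<kappa> = 0\<close>, where \<open>0\<close> is
  the correct one.\<close>

definition \<eta> :: real where "\<eta> = sqrt (\<kappa>\<^sup>2 - (\<kappa>\<^sup>2 / \<tau>)\<^sup>2)"

text \<open>The condition \<open>\<kappa> \<le> \<bar>\<tau>\<bar>\<close> covers both ways in which characteristic directions exist: a slice of
  height \<open>\<kappa>\<^sup>2 / \<tau>\<close> that meets a proper circle, and the degenerate circle \<open>\<kappa> = 0\<close>, for which every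
  direction is characteristic, whatever \<open>\<tau>\<close> is.\<close>

lemma characteristic_values:
  "{\<rho> w | w. w \<noteq> 0 \<and> qeval (Jac (Jac q r - \<beta> *\<^sub>R q) (Jac q (Jac q r))) w = 0} =
     (if \<kappa> \<le> \<bar>\<tau>\<bar> then {- \<eta>, \<eta>} else {})"
proof -
  have "{\<rho> w | w. w \<noteq> 0 \<and> qeval (Jac (Jac q r - \<beta> *\<^sub>R q) (Jac q (Jac q r))) w = 0} =
      {\<rho> w | w. w \<noteq> 0 \<and> \<tau> * \<sigma> w = \<kappa>\<^sup>2}" (is "_ = ?S")
    using characteristic_iff by blast
  also have "?S = (if \<kappa> \<le> \<bar>\<tau>\<bar> then {- \<eta>, \<eta>} else {})"
  proof (cases "\<kappa> = 0")
    case True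
    then have "\<sigma> w = 0" if "w \<noteq> 0" for w
      using circle[OF that] by (simp add: sum_power2_eq_zero_iff)
    then have "?S = {\<rho> w | w. w \<noteq> 0 \<and> \<sigma> w = 0}" using True by auto
    then show ?thesis using values_at_height[of 0] True by (simp add: \<eta>_def)
  next
    case False
    then have pos: "\<kappa> > 0" using \<kappa>_nonneg by simp
    show ?thesis
    proof (cases "\<tau> = 0")
      case True
      then show ?thesis using pos by simp
    next
      case \<tau>: False
      have "?S = {\<rho> w | w. w \<noteq> 0 \<and> \<sigma> w = \<kappa>\<^sup>2 / \<tau>}"
        using \<tau> by (simp add: field_simps)
      moreover have "\<bar>\<kappa>\<^sup>2 / \<tau>\<bar> \<le> \<kappa> \<longleftrightarrow> \<kappa> \<le> \<bar>\<tau>\<bar>"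
        using pos \<tau> by (simp add: abs_div divide_simps power2_eq_square)
      ultimately show ?thesis
        using values_at_height[of "\<kappa>\<^sup>2 / \<tau>"] no_values_beyond[of "\<kappa>\<^sup>2 / \<tau>"]
        by (simp add: \<eta>_def not_le[symmetric])
    qed
  qed
  finally show ?thesis .
qed

lemma \<eta>_eq_0: "\<kappa> = \<bar>\<tau>\<bar> \<Longrightarrow> \<eta> = 0"
  by (simp add: \<eta>_def power2_eq_square)

lemma \<eta>_nonneg: "\<kappa> \<le> \<bar>\<tau>\<bar> \<Longrightarrow> \<eta> \<ge> 0"
proof -
  assume le: "\<kappa> \<le> \<bar>\<tau>\<bar>"
  have "(\<kappa>\<^sup>2 / \<tau>)\<^sup>2 \<le> \<kappa>\<^sup>2"
  proof (cases "\<tau> = 0")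
    case False
    have "\<kappa>\<^sup>2 \<le> \<tau>\<^sup>2" using le \<kappa>_nonneg by (metis abs_le_square_iff abs_of_nonneg)
    then have "\<kappa>\<^sup>2 * \<kappa>\<^sup>2 \<le> \<kappa>\<^sup>2 * \<tau>\<^sup>2" by (rule mult_left_mono) simp
    then show ?thesis using False by (simp add: power_divide divide_simps power4_eq_xxxx power2_eq_square)
  qed simp
  then show ?thesis by (simp add: \<eta>_def)
qed

lemma \<eta>_le: "\<eta> \<le> \<kappa>"
  unfolding \<eta>_def using \<kappa>_nonneg by (intro real_le_lsqrt) auto

lemma \<eta>_less:
  assumes "\<kappa> > 0" "\<kappa> \<le> \<bar>\<tau>\<bar>"
  shows "\<eta> < \<kappa>"
proof -
  have "\<tau> \<noteq> 0" using assms by auto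
  then have "\<eta> < sqrt (\<kappa>\<^sup>2)"
    unfolding \<eta>_def using assms by (intro real_sqrt_less_mono) simp
  then show ?thesis using assms by simp
qed

end

section \<open>The special points on a line of the congruence\<close>

text \<open>Positivity of \<open>Q1\<close> at \<open>(1, 0)\<close> and at \<open>(-B, A)\<close> gives \<open>A > 0\<close> and \<open>D > 0\<close>, the second value
  being \<open>A D\<close>. The three sets of points are then the images of the slices under
  \<open>t \<mapsto> x + (m + t) n\<close>.\<close>

lemma central_points_configuration:
  assumes "central_points_defined f z"
  obtains m \<kappa> \<tau> \<eta> where
    "boundary_points f z = (\<lambda>t. x_of f z + (m + t) *\<^sub>R n_of f z) ` {- \<kappa>, \<kappa>}"
    "focal_points f z =
       (\<lambda>t. x_of f z + (m + t) *\<^sub>R n_of f z) `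
         (if \<bar>\<tau>\<bar> \<le> \<kappa> then {- sqrt (\<kappa>\<^sup>2 - \<tau>\<^sup>2), sqrt (\<kappa>\<^sup>2 - \<tau>\<^sup>2)} else {})"
    "characteristic_points f z =
       (\<lambda>t. x_of f z + (m + t) *\<^sub>R n_of f z) ` (if \<kappa> \<le> \<bar>\<tau>\<bar> then {- \<eta>, \<eta>} else {})"
    "\<kappa> \<ge> 0" "\<kappa> = \<bar>\<tau>\<bar> \<longrightarrow> \<eta> = 0" "\<kappa> \<le> \<bar>\<tau>\<bar> \<longrightarrow> \<eta> \<ge> 0" "\<eta> \<le> \<kappa>" "\<kappa> > 0 \<and> \<kappa> \<le> \<bar>\<tau>\<bar> \<longrightarrow> \<eta> < \<kappa>"
proof -
  have qI: "n' f z w \<bullet> n' f z w = qeval (Q1 f z) w" for w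
    by (cases w) (simp add: n'_def Q1_def cA_def cB_def cC_def inner_add inner_commute
        power2_eq_square algebra_simps)
  have qR: "- (x' f z w \<bullet> n' f z w) = qeval (ca f z, cb f z, cc f z) w" for w
    by (cases w) (simp add: n'_def x'_def ca_def cb_def cb1_def cb2_def cc_def inner_add
        inner_commute power2_eq_square algebra_simps)
  have pos: "qeval (Q1 f z) w > 0" if "w \<noteq> 0" for w
    using assms that qI[of w] inner_ge_zero[of "n' f z w"]
    unfolding central_points_defined_def by (metis less_le)
  have A: "cA f z > 0"
    using pos[of "(1, 0)"] by (simp add: Q1_def zero_prod_def)
  have "qeval (Q1 f z) (- cB f z, cA f z) = cA f z * (cA f z * cC f z - (cB f z)\<^sup>2)"
    by (simp add: Q1_def power2_eq_square algebra_simps)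
  then have D: "cA f z * cC f z - (cB f z)\<^sup>2 > 0"
    using pos[of "(- cB f z, cA f z)"] A by (simp add: zero_prod_def zero_less_mult_iff)
  interpret P: quadratic_pencil "cA f z" "cB f z" "cC f z" "ca f z" "cb f z" "cc f z" "cbbar f z"
    using A D by unfold_locales
  let ?q = "(cA f z, cB f z, cC f z)" and ?r = "(ca f z, cb f z, cc f z)"
  have forms: "Q2 f z = Jac ?q ?r" "Q3 f z = Jac ?q ?r - cbbar f z *\<^sub>R ?q"
    "Q5 f z = Jac (Jac ?q ?r - cbbar f z *\<^sub>R ?q) (Jac ?q (Jac ?q ?r))"
    by (simp_all only: Q5_def Q4_def Q3_def Q1_def Q2_def Jac.simps)
  define ax where "ax = (\<lambda>t. x_of f z + (P.mean + t) *\<^sub>R n_of f z)"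
  have "central_point f z w = ax (P.\<rho> w)" for w
    by (simp only: central_point_def qI qR Q1_def ax_def P.\<rho>_def) simp
  then have cp: "{central_point f z w | w. S w} = ax ` {P.\<rho> w | w. S w}" for S
    by auto
  show thesis
  proof (rule that[of P.mean P.\<kappa> P.\<tau> P.\<eta>, folded ax_def])
    show "boundary_points f z = ax ` {- P.\<kappa>, P.\<kappa>}"
      unfolding boundary_points_def principal_direction_def cp forms P.principal_values ..
    show "focal_points f z = ax `
         (if \<bar>P.\<tau>\<bar> \<le> P.\<kappa> then {- sqrt (P.\<kappa>\<^sup>2 - P.\<tau>\<^sup>2), sqrt (P.\<kappa>\<^sup>2 - P.\<tau>\<^sup>2)} else {})"
      unfolding focal_points_def torsal_direction_def cp forms P.torsal_values ..
    show "characteristic_points f z = ax ` (if P.\<kappa> \<le> \<bar>P.\<tau>\<bar> then {- P.\<eta>, P.\<eta>} else {})"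
      unfolding characteristic_points_def characteristic_direction_def cp forms
        P.characteristic_values ..
  qed (use P.\<kappa>_nonneg P.\<eta>_eq_0 P.\<eta>_nonneg P.\<eta>_le P.\<eta>_less in auto)
qed

lemma affine_line_closed_segment:
  fixes x n :: "'a::real_vector"
  assumes "\<bar>t\<bar> \<le> k"
  shows "x + (m + t) *\<^sub>R n \<in> closed_segment (x + (m - k) *\<^sub>R n) (x + (m + k) *\<^sub>R n)"
proof (cases "k = 0")
  case True
  then show ?thesis using assms by simp
next
  case False
  define u where "u = (t + k) / (2 * k)"
  have u: "0 \<le> u" "u \<le> 1" using assms False by (auto simp: u_def divide_simps)
  have "t + k = u * (2 * k)" using False by (simp add: u_def)
  then have t: "m + t = (1 - u) * (m - k) + u * (m + k)" by (simp add: algebra_simps)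
  have "(1 - u) *\<^sub>R (x + (m - k) *\<^sub>R n) + u *\<^sub>R (x + (m + k) *\<^sub>R n)
      = ((1 - u) + u) *\<^sub>R x + ((1 - u) * (m - k) + u * (m + k)) *\<^sub>R n"
    by (simp only: scaleR_add_left scaleR_add_right scaleR_scaleR distrib_left add_ac)
  then have "x + (m + t) *\<^sub>R n = (1 - u) *\<^sub>R (x + (m - k) *\<^sub>R n) + u *\<^sub>R (x + (m + k) *\<^sub>R n)"
    unfolding t[symmetric] by simp
  then show ?thesis using u by (auto simp: in_segment)
qed

text \<open>Two characteristic points need \<open>\<eta> \<noteq> 0\<close>, hence \<open>\<kappa> < \<bar>\<tau>\<bar>\<close>, where there is no torsal direction;
  two focal points need \<open>\<bar>\<tau>\<bar> < \<kappa>\<close>, where there is no characteristic one.\<close>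

lemma characteristic_points_position:
  assumes "central_points_defined f z"
  shows "finite (characteristic_points f z) \<and>
           card (characteristic_points f z) \<in> {2, 1, 0} \<and>
           (card (characteristic_points f z) = 2 \<longrightarrow> focal_points f z = {}) \<and>
           (card (focal_points f z) = 2 \<longrightarrow> characteristic_points f z = {}) \<and>
           (\<exists>p q. boundary_points f z = {p, q} \<and>
              (\<forall>c d. characteristic_points f z = {c, d} \<longrightarrow> midpoint c d = midpoint p q) \<and>
              characteristic_points f z \<subseteq> closed_segment p q \<and>
              (p \<noteq> q \<longrightarrow> characteristic_points f z \<subseteq> open_segment p q))"
proof -
  obtain m \<kappa> \<tau> \<eta> where
    bp: "boundary_points f z = (\<lambda>t. x_of f z + (m + t) *\<^sub>R n_of f z) ` {- \<kappa>, \<kappa>}" and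
    fp: "focal_points f z =
       (\<lambda>t. x_of f z + (m + t) *\<^sub>R n_of f z) `
         (if \<bar>\<tau>\<bar> \<le> \<kappa> then {- sqrt (\<kappa>\<^sup>2 - \<tau>\<^sup>2), sqrt (\<kappa>\<^sup>2 - \<tau>\<^sup>2)} else {})" and
    cp: "characteristic_points f z =
       (\<lambda>t. x_of f z + (m + t) *\<^sub>R n_of f z) ` (if \<kappa> \<le> \<bar>\<tau>\<bar> then {- \<eta>, \<eta>} else {})" and
    \<kappa>: "\<kappa> \<ge> 0" and \<eta>0: "\<kappa> = \<bar>\<tau>\<bar> \<longrightarrow> \<eta> = 0" and \<eta>: "\<kappa> \<le> \<bar>\<tau>\<bar> \<longrightarrow> \<eta> \<ge> 0"
      and \<eta>_le: "\<eta> \<le> \<kappa>" and \<eta>_less: "\<kappa> > 0 \<and> \<kappa> \<le> \<bar>\<tau>\<bar> \<longrightarrow> \<eta> < \<kappa>"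
    by (rule central_points_configuration[OF assms])
  define ax where "ax = (\<lambda>t. x_of f z + (m + t) *\<^sub>R n_of f z)"
  note bp = bp[folded ax_def] and fp = fp[folded ax_def] and cp = cp[folded ax_def]
  have mid: "midpoint (ax (- t)) (ax t) = ax 0" for t
    by (simp add: ax_def midpoint_eq_iff algebra_simps)
  have fin: "finite (characteristic_points f z)" by (simp add: cp)
  have card: "card (characteristic_points f z) \<in> {2, 1, 0}"
    by (auto simp: cp card_insert_if)
  have c2: "focal_points f z = {}" if "card (characteristic_points f z) = 2"
  proof -
    have "\<kappa> \<le> \<bar>\<tau>\<bar>" "\<eta> \<noteq> 0" using that by (auto simp: cp split: if_splits)
    then show ?thesis using \<eta>0 by (auto simp: fp)
  qed
  have f2: "characteristic_points f z = {}" if "card (focal_points f z) = 2"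
  proof -
    have "\<bar>\<tau>\<bar> \<le> \<kappa>" "\<kappa>\<^sup>2 - \<tau>\<^sup>2 \<noteq> 0" using that by (auto simp: fp split: if_splits)
    moreover have "\<bar>\<tau>\<bar> \<noteq> \<kappa>" using \<open>\<kappa>\<^sup>2 - \<tau>\<^sup>2 \<noteq> 0\<close> by auto
    ultimately have "\<bar>\<tau>\<bar> < \<kappa>" by simp
    then show ?thesis by (simp add: cp)
  qed
  have boundary: "boundary_points f z = {ax (- \<kappa>), ax \<kappa>}" by (simp add: bp)
  have midp: "midpoint c d = midpoint (ax (- \<kappa>)) (ax \<kappa>)" if "characteristic_points f z = {c, d}" for c d
  proof -
    have "{c, d} = {ax (- \<eta>), ax \<eta>}" using that by (auto simp: cp split: if_splits)
    then have "midpoint c d = midpoint (ax (- \<eta>)) (ax \<eta>)"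
      by (auto simp: doubleton_eq_iff midpoint_sym)
    then show ?thesis by (simp add: mid)
  qed
  have cl: "characteristic_points f z \<subseteq> closed_segment (ax (- \<kappa>)) (ax \<kappa>)"
  proof -
    have "ax t \<in> closed_segment (ax (- \<kappa>)) (ax \<kappa>)" if "\<bar>t\<bar> \<le> \<kappa>" for t
      using affine_line_closed_segment[OF that] by (simp add: ax_def)
    then show ?thesis using \<eta> \<eta>_le by (auto simp: cp)
  qed
  have op: "characteristic_points f z \<subseteq> open_segment (ax (- \<kappa>)) (ax \<kappa>)" if "ax (- \<kappa>) \<noteq> ax \<kappa>"
  proof -
    have "\<kappa> > 0" and n: "n_of f z \<noteq> 0" using that \<kappa> by (auto simp: ax_def less_le)
    then have "characteristic_points f z \<subseteq> ax ` {- \<kappa><..<\<kappa>}"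
      using \<eta>_less \<eta> by (auto simp: cp)
    moreover have "inj ax" using n by (auto simp: inj_def ax_def)
    then have "ax (- \<kappa>) \<notin> ax ` {- \<kappa><..<\<kappa>}" "ax \<kappa> \<notin> ax ` {- \<kappa><..<\<kappa>}"
      by (simp_all add: inj_image_mem_iff)
    ultimately have "ax (- \<kappa>) \<notin> characteristic_points f z" "ax \<kappa> \<notin> characteristic_points f z"
      by blast+
    then show ?thesis using cl by (auto simp: open_segment_def)
  qed
  show ?thesis using fin card c2 f2 boundary midp op cl by blast
qed

text \<open>The whole space is open and dense in itself.\<close>

lemma generic_if_always:
  assumes "\<And>f. P f"
  shows "generic_for_congruences U P"
  unfolding generic_for_congruences_def
  by (rule exI[of _ "topspace (line_map_space U)"]) (simp add: assms)

theorem theorem4p10: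
  fixes U :: "(real \<times> real) set"
  assumes "open U"
  shows "generic_for_congruences U (\<lambda>f. \<forall>z\<in>U. central_points_defined f z \<longrightarrow>
           finite (characteristic_points f z) \<and>
           card (characteristic_points f z) \<in> {2, 1, 0} \<and>
           (card (characteristic_points f z) = 2 \<longrightarrow> focal_points f z = {}) \<and>
           (card (focal_points f z) = 2 \<longrightarrow> characteristic_points f z = {}) \<and>
           (\<exists>p q. boundary_points f z = {p, q} \<and>
              (\<forall>c d. characteristic_points f z = {c, d} \<longrightarrow> midpoint c d = midpoint p q) \<and>
              characteristic_points f z \<subseteq> closed_segment p q \<and>
              (p \<noteq> q \<longrightarrow> characteristic_points f z \<subseteq> open_segment p q)))"
  by (intro generic_if_always ballI impI characteristic_points_position)

end
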